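(* For any $p$ and $q$ such that $0<p<q\le\infty$, the tail ratio $$\frac{G_q(x)}{G_p(x)}$$ is strictly decreasing in $x\in[0,\infty)$, which implies the strict stochastic majorization $$G_q(x)<G_p(x)\quad\text{for all } x>0.$$
   Context: For real $p>0$, the density and tail functions of Student's distribution with $p$ degrees of freedom are $$f_p(x):=\frac{\Gamma\left(\frac{p+1}{2}\right)}{\sqrt{\pi p}\,\Gamma\left(\frac p2\right)}\left(1+\frac{x^2}{p}\right)^{-(p+1)/2},\qquad G_p(x):=\int_x^\infty f_p(u)\,du,$$ for all real $x$, where $p$ may be any positive real number. By continuity, $f_\infty$ and $G_\infty$ are the density and tail functions of the standard normal distribution: $f_\infty(x)=\frac{1}{\sqrt{2\pi}}e^{-x^2/2}$, $G_\infty(x)=\int_x^\infty f_\infty(u)\,du$. *)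

theory Defs
  imports "HOL-Probability.Distributions"
begin

text \<open>Degrees of freedom range over \<open>(0, \<infinity>]\<close>, hence the type \<^typ>\<open>ereal\<close>; the value at
  \<open>p \<le> 0\<close> is irrelevant. For \<open>p = \<infinity>\<close> the distribution is the standard normal one.\<close>

definition student_density :: "ereal \<Rightarrow> real \<Rightarrow> real" where
  "student_density p x =
     (if p = \<infinity> then std_normal_density x
      else let r = real_of_ereal p in
        Gamma ((r + 1) / 2) / (sqrt (pi * r) * Gamma (r / 2)) *
          (1 + x\<^sup>2 / r) powr (- (r + 1) / 2))"

definition student_tail :: "ereal \<Rightarrow> real \<Rightarrow> real" where
  "student_tail p x = (LBINT u:{x..}. student_density p u)"

end

theory Submission
  imports Defs
begin

text \<open>With \<open>a\<^sub>p(x) = (p + 1) x / (p + x\<^sup>2)\<close>, and \<open>a\<^sub>\<infinity>(x) = x\<close>, the density ratio \<open>h = f\<^sub>q / f\<^sub>p\<close>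
  has logarithmic derivative \<open>a\<^sub>p - a\<^sub>q\<close>, which on the positive axis has the sign of \<open>1 - x\<^sup>2\<close>. The
  derivative of \<open>G\<^sub>q / G\<^sub>p\<close> has the sign of \<open>- D\<close>, where \<open>D = h G\<^sub>p - G\<^sub>q\<close> and \<open>D' = h' G\<^sub>p\<close>. So \<open>D\<close>
  first increases from \<open>D(0) = (h(0) - 1) / 2\<close> and then decreases to \<open>0\<close> at infinity, and it is
  positive as soon as \<open>h(0) > 1\<close>. The latter says that \<open>\<Gamma>(s + 1/2) / (\<surd>s \<Gamma>(s))\<close> increases in \<open>s\<close> towards
  its limit \<open>1\<close>, which is a consequence of the strict concavity of the digamma function.\<close>

section \<open>Tail integrals: derivative and limit at infinity\<close>

lemma set_integrable_lborel_atLeast_shift: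
  fixes f :: "real \<Rightarrow> real"
  assumes "continuous_on UNIV f" "set_integrable lborel {a..} f"
  shows "set_integrable lborel {b..} f"
proof -
  have "set_integrable lborel {b..a} f"
    by (rule borel_integrable_atLeastAtMost') (use assms(1) continuous_on_subset in blast)
  then have "set_integrable lborel ({b..a} \<union> {a..}) f"
    by (rule set_integrable_Un) (use assms(2) in auto)
  then show ?thesis
    by (rule set_integrable_subset) auto
qed

text \<open>For \<open>y\<close> near \<open>x\<close> the tail splits at the fixed point
  \<open>x + 1\<close> into an integral over a compact interval and a constant, so the fundamental
  theorem of calculus at the lower endpoint applies.\<close>

lemma has_real_derivative_tail_integral:
  fixes f :: "real \<Rightarrow> real"
  assumes cont: "continuous_on UNIV f" and int: "set_integrable lborel {a..} f"
  shows "((\<lambda>x. LBINT u:{x..}. f u) has_real_derivative - f x) (at x)"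
proof -
  have cont': "continuous_on {x - 1..x + 1} f"
    using cont continuous_on_subset by blast
  have int_c: "set_integrable lborel {c..d} f" for c d
    by (rule borel_integrable_atLeastAtMost') (use cont continuous_on_subset in blast)
  have tail: "(LBINT u:{y..}. f u) = integral {y..x + 1} f + (LBINT u:{x + 1<..}. f u)"
    if "y \<in> {x - 1<..<x + 1}" for y
  proof -
    have "{y..} = {y..x + 1} \<union> {x + 1<..}"
      using that by auto
    moreover have "set_integrable lborel {x + 1<..} f"
      by (rule set_integrable_subset[OF set_integrable_lborel_atLeast_shift[OF cont int, of "x + 1"]]) auto
    moreover have "{y..x + 1} \<inter> {x + 1<..} = {}"
      by auto
    ultimately have "(LBINT u:{y..}. f u) = (LBINT u:{y..x + 1}. f u) + (LBINT u:{x + 1<..}. f u)"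
      by (simp only: set_integral_Un int_c)
    then show ?thesis
      by (simp add: set_borel_integral_eq_integral(2)[OF int_c])
  qed
  have "((\<lambda>y. integral {y..x + 1} f) has_real_derivative - f x) (at x within {x - 1..x + 1})"
    by (rule integral_has_real_derivative'[OF cont']) auto
  then have "((\<lambda>y. integral {y..x + 1} f) has_real_derivative - f x) (at x)"
    by (simp add: at_within_Icc_at)
  then have "((\<lambda>y. integral {y..x + 1} f + (LBINT u:{x + 1<..}. f u)) has_real_derivative - f x) (at x)"
    by (auto intro!: derivative_eq_intros)
  then show ?thesis
    by (rule has_field_derivative_transform_within_open[of _ _ _ "{x - 1<..<x + 1}"])
      (auto simp: tail)
qed

text \<open>Beyond \<open>a\<close> the tail is the total integral over \<open>{a..}\<close> minus
  the part up to \<open>x\<close>, and the latter converges to the total.\<close>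

lemma tail_integral_tendsto_0:
  fixes f :: "real \<Rightarrow> real"
  assumes int: "set_integrable lborel {a..} f"
  shows "((\<lambda>x. LBINT u:{x..}. f u) \<longlongrightarrow> 0) at_top"
proof -
  let ?g = "\<lambda>u. indicator {a..} u *\<^sub>R f u"
  have g: "integrable lborel ?g"
    using int by (simp add: set_integrable_def)
  have "((\<lambda>x. (\<integral>u. ?g u \<partial>lborel) - (\<integral>u. indicator {..x} u *\<^sub>R ?g u \<partial>lborel)) \<longlongrightarrow>
      (\<integral>u. ?g u \<partial>lborel) - (\<integral>u. ?g u \<partial>lborel)) at_top"
    by (intro tendsto_intros tendsto_integral_at_top g) simp
  moreover have "\<forall>\<^sub>F x in at_top. (\<integral>u. ?g u \<partial>lborel) - (\<integral>u. indicator {..x} u *\<^sub>R ?g u \<partial>lborel)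
      = (LBINT u:{x..}. f u)"
    using eventually_ge_at_top[of a]
  proof eventually_elim
    case (elim x)
    have "(\<integral>u. ?g u \<partial>lborel) - (\<integral>u. indicator {..x} u *\<^sub>R ?g u \<partial>lborel)
      = (\<integral>u. ?g u - indicator {..x} u *\<^sub>R ?g u \<partial>lborel)"
      by (rule Bochner_Integration.integral_diff[symmetric, OF g])
        (intro integrable_mult_indicator g; simp)
    also have "\<dots> = (\<integral>u. indicator {x..} u *\<^sub>R f u \<partial>lborel)"
    proof (rule integral_cong_AE)
      show "(\<lambda>u. indicator {x..} u *\<^sub>R f u) \<in> borel_measurable lborel"
        using set_integrable_subset[OF int, of "{x..}"] elim
        by (auto simp: set_integrable_def)
      show "(\<lambda>u. ?g u - indicator {..x} u *\<^sub>R ?g u) \<in> borel_measurable lborel"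
        using borel_measurable_integrable[OF g] by measurable
      \<comment> \<open>The left side is supported on \<open>{x<..}\<close>, so the two integrands
        can differ only at \<open>u = x\<close>.\<close>
      show "AE u in lborel. ?g u - indicator {..x} u *\<^sub>R ?g u = indicator {x..} u *\<^sub>R f u"
        using AE_lborel_singleton[of x] by eventually_elim (use elim in \<open>auto simp: indicator_def\<close>)
    qed
    finally show ?case
      by (simp add: set_lebesgue_integral_def)
  qed
  ultimately show ?thesis
    by (simp add: filterlim_cong)
qed

section \<open>A monotonicity criterion for ratios of tails\<close>

text \<open>Here \<open>a\<close> and \<open>b\<close> are minus the logarithmic derivatives of
  \<open>f\<close> and \<open>g\<close>, and \<open>c\<close> is the point after which
  \<open>h = g / f\<close> starts to decrease. For the Student family \<open>c = 1\<close>.\<close>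

lemma tail_ratio_strict_antimono_on:
  fixes f g F G a b :: "real \<Rightarrow> real"
  assumes f: "\<And>x. (f has_real_derivative - a x * f x) (at x)" "\<And>x. f x > 0"
    and g: "\<And>x. (g has_real_derivative - b x * g x) (at x)" "\<And>x. g x > 0"
    and F: "\<And>x. (F has_real_derivative - f x) (at x)" "(F \<longlongrightarrow> 0) at_top"
    and G: "\<And>x. (G has_real_derivative - g x) (at x)" "(G \<longlongrightarrow> 0) at_top"
    and start: "F 0 = G 0" "f 0 < g 0"
    and c: "0 \<le> c"
    and up: "\<And>x. 0 \<le> x \<Longrightarrow> x \<le> c \<Longrightarrow> b x \<le> a x"
    and down: "\<And>x. c < x \<Longrightarrow> a x < b x"
  shows "strict_antimono_on {0..} (\<lambda>x. G x / F x)"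
proof -
  have F_pos: "F x > 0" for x
    using DERIV_neg_imp_decreasing_at_top[of x F 0] F f(2) by (metis neg_less_0_iff_less)
  define h where "h x = g x / f x" for x
  define D where "D x = h x * F x - G x" for x
  have h_pos: "h x > 0" for x
    using f(2) g(2) by (simp add: h_def)
  have h': "(h has_real_derivative (a x - b x) * h x) (at x)" for x
    unfolding h_def using f(2)[of x]
    by (auto intro!: derivative_eq_intros f(1) g(1) simp: field_simps power2_eq_square)
  \<comment> \<open>The product rule also yields \<open>- h x * f x + g x\<close>, which cancels
    because \<open>h x * f x = g x\<close>.\<close>
  have D': "(D has_real_derivative (a x - b x) * h x * F x) (at x)" for x
    unfolding D_def
    by (rule derivative_eq_intros h' F(1) G(1) refl)+ (use f(2)[of x] in \<open>simp add: h_def field_simps\<close>)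
  \<comment> \<open>This bound lets \<open>h x * F x\<close> inherit the limit 0 from
    \<open>F\<close>.\<close>
  have h_le: "h x \<le> h c" if "c \<le> x" for x
  proof (cases "x = c")
    case False
    with that have "c < x" by simp
    then have "h x < h c"
    \<comment> \<open>The open version is needed because \<open>down\<close> says nothing at
      \<open>c\<close> itself, where \<open>h'\<close> may vanish.\<close>
    proof (rule DERIV_neg_imp_decreasing_open)
      show "continuous_on {c..x} h"
        by (meson DERIV_atLeastAtMost_imp_continuous_on h')
      show "\<exists>y. (h has_real_derivative y) (at u) \<and> y < 0" if "c < u" for u
        using down[OF that] h_pos[of u] h'[of u]
        by (meson diff_less_0_iff_less mult_neg_pos)
    qed
    then show ?thesis by simp
  qed simp
  have "((\<lambda>x. h x * F x) \<longlongrightarrow> 0) at_top"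
  proof (rule tendsto_sandwich[OF _ _ tendsto_const])
    show "((\<lambda>x. h c * F x) \<longlongrightarrow> 0) at_top"
      using tendsto_mult_right_zero[OF F(2)] by simp
    show "\<forall>\<^sub>F x in at_top. h x * F x \<le> h c * F x"
      using eventually_ge_at_top[of c] by eventually_elim (use h_le F_pos less_imp_le in \<open>auto intro: mult_right_mono\<close>)
    show "\<forall>\<^sub>F x in at_top. 0 \<le> h x * F x"
      using h_pos F_pos by (simp add: less_imp_le)
  qed
  then have D_lim: "(D \<longlongrightarrow> 0) at_top"
    unfolding D_def using tendsto_diff[OF _ G(2)] by fastforce
  have D_pos: "D x > 0" if "x \<ge> 0" for x
  proof (cases "x \<le> c")
    case True
    \<comment> \<open>Since \<open>F 0 = G 0\<close>, the value is \<open>(h 0 - 1) * F 0\<close>,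
      and \<open>h 0 > 1\<close>.\<close>
    have "0 < D 0"
      using start f(2)[of 0] F_pos[of 0] by (simp add: D_def h_def field_simps)
    also have "D 0 \<le> D x"
    proof (rule DERIV_nonneg_imp_nondecreasing[OF that])
      show "\<exists>y. (D has_real_derivative y) (at u) \<and> 0 \<le> y" if "0 \<le> u" "u \<le> x" for u
        using D'[of u] up[of u] h_pos[of u] F_pos[of u] that True
        by (meson diff_ge_0_iff_ge less_imp_le mult_nonneg_nonneg order_trans)
    qed
    finally show ?thesis .
  next
    case False
    show ?thesis
    \<comment> \<open>Beyond \<open>c\<close>, a function strictly decreasing to 0 must be
      positive.\<close>
    proof (rule DERIV_neg_imp_decreasing_at_top[OF _ D_lim])
      show "\<exists>y. (D has_real_derivative y) (at u) \<and> y < 0" if "x \<le> u" for u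
        using D'[of u] down[of u] h_pos[of u] F_pos[of u] that False
        by (intro exI[of _ "(a u - b u) * h u * F u"]) (simp add: mult_neg_pos)
    qed
  qed
  show ?thesis
  proof (rule monotone_onI)
    fix x y :: real
    assume "x \<in> {0..}" "y \<in> {0..}" "x < y"
    show "G y / F y < G x / F x"
      using \<open>x < y\<close>
    proof (rule DERIV_neg_imp_decreasing)
      fix u assume "x \<le> u"
      then have D: "D u > 0"
        using D_pos \<open>x \<in> {0..}\<close> by auto
      have "((\<lambda>u. G u / F u) has_real_derivative (- g u * F u - G u * - f u) / (F u * F u)) (at u)"
        using F_pos[of u] by (intro DERIV_divide F(1) G(1)) auto
      also have "(- g u * F u - G u * - f u) / (F u * F u) = - (f u * D u) / (F u * F u)"
        using f(2)[of u] by (simp add: D_def h_def right_diff_distrib mult.commute)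
      finally show "\<exists>y. ((\<lambda>u. G u / F u) has_real_derivative y) (at u) \<and> y < 0"
        using f(2)[of u] F_pos[of u] D by (meson divide_neg_pos mult_pos_pos neg_less_0_iff_less)
    qed
  qed
qed

section \<open>The Gamma ratio behind the density at the origin\<close>

text \<open>The increments of \<open>Digamma\<close> over the two halves of the interval from
  \<open>s\<close> to \<open>s + 1\<close> add up to \<open>1 / s\<close>. As
  \<open>Polygamma 1\<close> strictly decreases, the first increment is the larger one and so
  exceeds half of the sum.\<close>

lemma half_inverse_less_Digamma_diff:
  fixes s :: real
  assumes "s > 0"
  shows "1 / (2 * s) < Digamma (s + 1 / 2) - Digamma s"
proof -
  have der: "DERIV Digamma x :> Polygamma 1 x" if "x > 0" for x :: real
    using that by (auto intro!: derivative_eq_intros elim!: nonpos_Ints_cases')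
  obtain u where u: "s < u" "u < s + 1 / 2"
      "Digamma (s + 1 / 2) - Digamma s = (s + 1 / 2 - s) * Polygamma 1 u"
    using MVT2[of s "s + 1 / 2" Digamma "Polygamma 1"] der assms by auto
  obtain v where v: "s + 1 / 2 < v" "v < s + 1"
      "Digamma (s + 1) - Digamma (s + 1 / 2) = (s + 1 - (s + 1 / 2)) * Polygamma 1 v"
    using MVT2[of "s + 1 / 2" "s + 1" Digamma "Polygamma 1"] der assms by auto
  have "Polygamma 1 v < Polygamma 1 u"
    using u v assms by (intro Polygamma_real_strict_antimono) auto
  moreover have "Digamma (s + 1) = Digamma s + 1 / s"
    using Digamma_plus1[of s] assms by auto
  ultimately show ?thesis
    using u(3) v(3) by (simp add: field_simps)
qed

text \<open>The logarithm \<open>?L\<close> of the ratio has a positive derivative by the preceding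
  inequality for \<open>Digamma\<close>.\<close>

lemma Gamma_half_ratio_strict_mono:
  fixes s t :: real
  assumes "0 < s" "s < t"
  shows "Gamma (s + 1 / 2) / (sqrt s * Gamma s) < Gamma (t + 1 / 2) / (sqrt t * Gamma t)"
proof -
  let ?L = "\<lambda>s::real. ln_Gamma (s + 1 / 2) - ln_Gamma s - ln s / 2"
  have "?L s < ?L t"
  proof (rule DERIV_pos_imp_increasing[OF assms(2)])
    fix x assume "s \<le> x"
    then have x: "x > 0" using assms by simp
    have "(?L has_real_derivative Digamma (x + 1 / 2) - Digamma x - 1 / (2 * x)) (at x)"
      using x by (auto intro!: derivative_eq_intros)
    then show "\<exists>y. (?L has_real_derivative y) (at x) \<and> y > 0"
      using half_inverse_less_Digamma_diff[OF x] by (intro exI conjI) auto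
  qed
  moreover have "Gamma (x + 1 / 2) / (sqrt x * Gamma x) = exp (?L x)" if "x > 0" for x :: real
  proof -
    have "exp (ln x / 2) = sqrt x"
      using that by (simp flip: ln_sqrt)
    then show ?thesis
      using that by (simp add: exp_diff Gamma_real_pos_exp)
  qed
  ultimately show ?thesis
    using assms by simp
qed

text \<open>No limit at infinity is computed: log-convexity of \<open>Gamma\<close>, at the midpoint
  of \<open>s + 1\<close> and \<open>s + 2\<close>, bounds the ratio at \<open>s + 1\<close> by 1,
  and strict monotonicity makes the bound strict at \<open>s\<close>.\<close>

lemma Gamma_half_ratio_less_1:
  fixes s :: real
  assumes "0 < s"
  shows "Gamma (s + 1 / 2) / (sqrt s * Gamma s) < 1"
proof -
  let ?t = "s + 1"
  have "ln (Gamma (?t + 1 / 2)) \<le> (1 / 2) * ln (Gamma ?t) + (1 / 2) * ln (Gamma (?t + 1))"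
    using convex_onD[OF log_convex_Gamma_real, of "1 / 2" ?t "?t + 1"] assms
    by (simp add: o_def add_divide_distrib)
  also have "Gamma (?t + 1) = ?t * Gamma ?t"
    using Gamma_plus1[of ?t] assms nonpos_Ints_nonpos[of ?t] by fastforce
  also have "(1 / 2) * ln (Gamma ?t) + (1 / 2) * ln (?t * Gamma ?t) = ln (sqrt ?t * Gamma ?t)"
    using assms Gamma_real_pos[of ?t] by (simp add: ln_mult_pos ln_sqrt add_divide_distrib)
  finally have "Gamma (?t + 1 / 2) \<le> sqrt ?t * Gamma ?t"
    using assms Gamma_real_pos[of ?t] Gamma_real_pos[of "?t + 1 / 2"] by (subst (asm) ln_le_cancel_iff) auto
  then have "Gamma (?t + 1 / 2) / (sqrt ?t * Gamma ?t) \<le> 1"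
    using assms Gamma_real_pos[of ?t] by simp
  then show ?thesis
    using Gamma_half_ratio_strict_mono[of s ?t] assms by linarith
qed

section \<open>Normalisation integral of the Student kernel\<close>

text \<open>The substitution \<open>t = r / (r + x^2)\<close> maps the positive axis bijectively
  onto the open unit interval and turns the kernel, up to a constant factor, into the Beta
  integrand.\<close>

lemma has_integral_student_kernel:
  fixes r :: real
  assumes "0 < r"
  shows "((\<lambda>x. (1 + x\<^sup>2 / r) powr (- (r + 1) / 2)) has_integral sqrt r / 2 * Beta (r / 2) (1 / 2)) {0<..}"
proof -
  let ?g = "\<lambda>x::real. r / (r + x\<^sup>2)" and ?g' = "\<lambda>x::real. - (2 * r * x) / (r + x\<^sup>2)\<^sup>2"
  let ?f = "\<lambda>t::real. t powr (r / 2 - 1) * (1 - t) powr (1 / 2 - 1)"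
  let ?k = "\<lambda>x::real. (1 + x\<^sup>2 / r) powr (- (r + 1) / 2)"
  have pos: "r + x\<^sup>2 > 0" for x :: real
    using assms by (simp add: add_pos_nonneg)
  have image: "?g ` {0<..} = {0<..<1}"
  proof (intro equalityI subsetI)
    fix t assume "t \<in> ?g ` {0<..}"
    then show "t \<in> {0<..<1}"
      using assms pos by auto
  next
    fix t :: real assume t: "t \<in> {0<..<1}"
    \<comment> \<open>This is the value of \<open>x^2\<close> that solves
      \<open>r / (r + x^2) = t\<close>.\<close>
    then have "r * (1 - t) / t > 0"
      using assms by simp
    then have "?g (sqrt (r * (1 - t) / t)) = t" "sqrt (r * (1 - t) / t) \<in> {0<..}"
      using t assms by (auto simp: field_simps)
    then show "t \<in> ?g ` {0<..}"
      by (metis image_eqI)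
  qed
  have inj: "inj_on ?g {0<..}"
  proof (rule inj_onI)
    fix x y :: real
    assume xy: "x \<in> {0<..}" "y \<in> {0<..}" "?g x = ?g y"
    then have "x\<^sup>2 = y\<^sup>2"
      using assms pos[of x] pos[of y] by (simp add: field_simps)
    then show "x = y"
      using xy by (simp add: power2_eq_iff_nonneg)
  qed
  have deriv: "(?g has_field_derivative ?g' x) (at x within {0<..})" for x
    using pos[of x] by (auto intro!: derivative_eq_intros simp: power2_eq_square)
  \<comment> \<open>With \<open>w = 1 + x^2 / r\<close> one has \<open>?g x = 1 / w\<close>,
    \<open>1 - ?g x = x^2 / (r * w)\<close> and
    \<open>\<bar>?g' x\<bar> = 2 * x / (r * w^2)\<close>. The exponents of \<open>w\<close> add up
    to \<open>- 2 - (r / 2 - 1) + 1 / 2 = - (r + 1) / 2\<close>.\<close>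
  have kernel: "\<bar>?g' x\<bar> * ?f (?g x) = 2 / sqrt r * ?k x" if "x \<in> {0<..}" for x
  proof -
    from that have x: "x > 0" by simp
    define w where "w = 1 + x\<^sup>2 / r"
    have w: "w > 0"
      using assms by (simp add: w_def add_pos_nonneg)
    have rw: "r + x\<^sup>2 = r * w"
      using assms by (simp add: w_def field_simps)
    have g: "?g x = w powr - 1"
      using assms w by (simp add: rw powr_minus field_simps)
    have "1 - ?g x = x\<^sup>2 / r * w powr - 1"
      using assms w pos[of x] by (simp add: powr_minus field_simps flip: rw)
    also have "\<dots> powr (1 / 2 - 1) = (x / sqrt r) powr - 1 * w powr (1 / 2)"
    proof -
      have "x\<^sup>2 / r = (x / sqrt r) powr 2"
        using x assms by (simp add: power_divide)
      moreover have "(x\<^sup>2 / r * w powr - 1) powr (1 / 2 - 1) =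
          (x\<^sup>2 / r) powr (1 / 2 - 1) * (w powr - 1) powr (1 / 2 - 1)"
        by (rule powr_mult; use x assms in simp)
      ultimately show ?thesis
        by (simp only: powr_powr) simp
    qed
    finally have h: "(1 - ?g x) powr (1 / 2 - 1) = sqrt r / x * w powr (1 / 2)"
      using x assms by (simp add: powr_minus)
    have "\<bar>?g' x\<bar> = 2 * x / r * w powr - 2"
      unfolding rw using x assms w by (simp add: powr_minus power2_eq_square abs_mult field_simps)
    moreover have "?g x powr (r / 2 - 1) = w powr - (r / 2 - 1)"
      unfolding g powr_powr by simp
    ultimately have "\<bar>?g' x\<bar> * ?f (?g x) =
        2 * x / r * (sqrt r / x) * (w powr - 2 * (w powr - (r / 2 - 1) * w powr (1 / 2)))"
      by (simp only: h mult_ac)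
    also have "w powr - 2 * (w powr - (r / 2 - 1) * w powr (1 / 2)) = ?k x"
      unfolding w_def[symmetric] powr_add[symmetric] by (simp add: field_simps)
    also have "2 * x / r * (sqrt r / x) = 2 / sqrt r"
      using x assms by (simp add: field_simps)
    finally show ?thesis .
  qed
  have Beta: "(?f has_integral Beta (r / 2) (1 / 2)) {0<..<1}"
    using has_integral_Beta_real[of "r / 2" "1 / 2"] assms by (simp add: has_integral_Icc_iff_Ioo)
  \<comment> \<open>The change of variables rule works with absolute integrability, which
    nonnegativity of the integrand provides.\<close>
  then have "?f absolutely_integrable_on {0<..<1}"
    by (intro nonnegative_absolutely_integrable_1) auto
  then have "(\<lambda>x. \<bar>?g' x\<bar> * ?f (?g x)) absolutely_integrable_on {0<..} \<and>
      integral {0<..} (\<lambda>x. \<bar>?g' x\<bar> * ?f (?g x)) = Beta (r / 2) (1 / 2)"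
    using has_absolute_integral_change_of_variables_1'[of "{0<..}" ?g ?g' ?f] deriv inj image Beta
    by (auto simp: integral_unique)
  then have k: "(\<lambda>x. 2 / sqrt r * ?k x) absolutely_integrable_on {0<..}"
      "integral {0<..} (\<lambda>x. 2 / sqrt r * ?k x) = Beta (r / 2) (1 / 2)"
    by (simp_all only: set_integrable_cong[OF refl refl kernel]
        Henstock_Kurzweil_Integration.integral_cong[OF kernel])
  have "(\<lambda>x. sqrt r / 2 * (2 / sqrt r * ?k x)) absolutely_integrable_on {0<..}"
    using k(1) by (rule set_integrable_mult_right)
  then have abs_k: "?k absolutely_integrable_on {0<..}"
    using assms by simp
  have "integral {0<..} ?k = sqrt r / 2 * Beta (r / 2) (1 / 2)"
    using k(2) assms by (simp add: field_simps)
  then show "(?k has_integral sqrt r / 2 * Beta (r / 2) (1 / 2)) {0<..}"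
    using abs_k has_integral_iff set_lebesgue_integral_eq_integral(1) by blast
qed

section \<open>Positivity, logarithmic derivative and continuity of the densities\<close>

lemma student_density_ereal:
  "student_density (ereal r) x =
     Gamma ((r + 1) / 2) / (sqrt (pi * r) * Gamma (r / 2)) * (1 + x\<^sup>2 / r) powr (- (r + 1) / 2)"
  by (simp add: student_density_def)

lemma student_density_PInfty: "student_density \<infinity> x = std_normal_density x"
  by (simp add: student_density_def)

lemma pos_ereal_cases:
  fixes p :: ereal
  assumes "0 < p"
  obtains r where "p = ereal r" "0 < r" | "p = \<infinity>"
  using assms by (cases p) auto

lemma student_density_pos:
  assumes "0 < p"
  shows "student_density p x > 0"
  using assms
proof (cases rule: pos_ereal_cases)
  case (1 r)
  then have "1 + x\<^sup>2 / r > 0"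
    by (simp add: add_pos_nonneg)
  with 1 show ?thesis
    by (simp add: student_density_ereal Gamma_real_pos)
next
  case 2
  then show ?thesis
    by (simp add: student_density_PInfty normal_density_pos)
qed

text \<open>Minus the logarithmic derivative of the density.\<close>

definition student_score :: "ereal \<Rightarrow> real \<Rightarrow> real" where
  "student_score p x =
     (if p = \<infinity> then x else (real_of_ereal p + 1) * x / (real_of_ereal p + x\<^sup>2))"

lemma has_real_derivative_student_density:
  assumes "0 < p"
  shows "(student_density p has_real_derivative - student_score p x * student_density p x) (at x)"
  using assms
proof (cases rule: pos_ereal_cases)
  case (1 r)
  define w where "w = 1 + x\<^sup>2 / r"
  define e where "e = - (r + 1) / 2"
  have w: "w > 0"
    using 1 by (simp add: w_def add_pos_nonneg)
  have rw: "r + x\<^sup>2 = r * w"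
    using 1 by (simp add: w_def field_simps)
  have "((\<lambda>x. 1 + x\<^sup>2 / r) has_real_derivative 2 * x / r) (at x)"
    using 1 by (auto intro!: derivative_eq_intros)
  then have "((\<lambda>x. (1 + x\<^sup>2 / r) powr e) has_real_derivative e * w powr (e - 1) * (2 * x / r)) (at x)"
    using w unfolding w_def by (intro DERIV_chain2[OF has_real_derivative_powr])
  also have "e * w powr (e - 1) * (2 * x / r) = e * 2 * x / (r * w) * w powr e"
    using w by (simp add: powr_diff mult_ac)
  also have "e * 2 * x / (r * w) = - student_score p x"
    using 1 w by (simp add: student_score_def rw e_def field_simps)
  finally have "((\<lambda>x. Gamma ((r + 1) / 2) / (sqrt (pi * r) * Gamma (r / 2)) * (1 + x\<^sup>2 / r) powr e)
      has_real_derivative Gamma ((r + 1) / 2) / (sqrt (pi * r) * Gamma (r / 2)) * (- student_score p x * w powr e)) (at x)"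
    by (rule DERIV_cmult)
  then show ?thesis
    using 1 by (simp add: student_density_ereal[abs_def] w_def e_def mult_ac)
next
  case 2
  have "((\<lambda>x. exp (- x\<^sup>2 / 2)) has_real_derivative - x * exp (- x\<^sup>2 / 2)) (at x)"
    by (auto intro!: derivative_eq_intros)
  from DERIV_cmult[OF this, of "1 / sqrt (2 * pi)"] show ?thesis
    using 2 by (simp add: student_density_PInfty[abs_def] student_score_def std_normal_density_def)
qed

lemma continuous_on_student_density:
  assumes "0 < p"
  shows "continuous_on UNIV (student_density p)"
  using DERIV_isCont[OF has_real_derivative_student_density[OF assms]]
  by (simp add: continuous_at_imp_continuous_on)

section \<open>Half mass, value at the origin, and crossing of the scores\<close>

text \<open>Integrability makes the general facts on tail integrals applicable, and the common value
  \<open>1 / 2\<close> gives all tails the same starting point at 0.\<close>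

lemma student_density_half_mass:
  assumes "0 < p"
  shows "set_integrable lborel {0..} (student_density p)" "student_tail p 0 = 1 / 2"
proof -
  have "has_bochner_integral lborel (\<lambda>x. indicator {0..} x *\<^sub>R student_density p x) (1 / 2)"
    using assms
  proof (cases rule: pos_ereal_cases)
    case (1 r)
    let ?c = "Gamma ((r + 1) / 2) / (sqrt (pi * r) * Gamma (r / 2))"
    have Gamma_nz: "Gamma y \<noteq> 0" if "y > 0" for y :: real
      using Gamma_real_pos[OF that] by (rule less_imp_neq[THEN not_sym])
    have "(student_density p has_integral ?c * (sqrt r / 2 * Beta (r / 2) (1 / 2))) {0<..}"
      using has_integral_mult_right[OF has_integral_student_kernel[OF 1(2)], of ?c] 1
      by (simp add: student_density_ereal[abs_def])
    \<comment> \<open>Writing \<open>Beta\<close> through \<open>Gamma\<close> with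
      \<open>Gamma (1 / 2) = sqrt pi\<close> cancels everything except the factor
      \<open>1 / 2\<close>.\<close>
    also have "?c * (sqrt r / 2 * Beta (r / 2) (1 / 2)) = 1 / 2"
      using 1 Gamma_nz[of "r / 2"] Gamma_nz[of "r / 2 + 1 / 2"]
      by (simp add: Beta_def Gamma_one_half_real real_sqrt_mult add_divide_distrib)
    finally have "(student_density p has_integral 1 / 2) {0..}"
      by (rule iffD1[OF has_integral_spike_set_eq[OF negligible_subset[OF negligible_sing[of 0]]
              negligible_subset[OF negligible_sing[of 0]]], rotated 2]) auto
    then have "((\<lambda>x. indicator {0..} x *\<^sub>R student_density p x) has_integral 1 / 2) UNIV"
      by (subst (asm) has_integral_restrict_UNIV[symmetric])
        (simp add: indicator_def of_bool_def if_distrib[of "\<lambda>c. c * _"] cong: if_cong)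
    moreover have "(\<lambda>x. indicator {0..} x *\<^sub>R student_density p x) \<in> borel_measurable borel"
      using borel_measurable_continuous_onI[OF continuous_on_student_density[OF assms]] by measurable
    ultimately show ?thesis
      using student_density_pos[OF assms]
      by (intro has_bochner_integral_nn_integral nn_integral_has_integral_lborel)
        (auto simp: less_imp_le indicator_def)
  next
    case 2
    \<comment> \<open>The half-line integral of \<open>exp (- x^2)\<close> is
      \<open>sqrt pi / 2\<close>. It is rescaled by \<open>1 / sqrt 2\<close>, with a zero shift
      written out to match the affine substitution rule.\<close>
    have "has_bochner_integral lborel
        (\<lambda>x. (1 / sqrt (2 * pi)) *\<^sub>R (indicator {0..} (0 + 1 / sqrt 2 * x) *\<^sub>R exp (- (0 + 1 / sqrt 2 * x)\<^sup>2)))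
        ((1 / sqrt (2 * pi)) *\<^sub>R ((sqrt pi / 2) /\<^sub>R \<bar>1 / sqrt 2\<bar>))"
      by (intro has_bochner_integral_scaleR_right iffD1[OF lborel_has_bochner_integral_real_affine_iff]
          gaussian_moment_0) auto
    moreover have "(1 / sqrt (2 * pi)) *\<^sub>R ((sqrt pi / 2) /\<^sub>R \<bar>1 / sqrt 2\<bar>) = 1 / 2"
      by (simp add: real_sqrt_mult field_simps)
    moreover have "(1 / sqrt (2 * pi)) *\<^sub>R (indicator {0..} (0 + 1 / sqrt 2 * x) *\<^sub>R exp (- (0 + 1 / sqrt 2 * x)\<^sup>2))
        = indicator {0..} x *\<^sub>R student_density p x" for x :: real
      using 2 by (simp add: student_density_PInfty std_normal_density_def indicator_def power_divide zero_le_divide_iff)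
    ultimately show ?thesis
      by simp
  qed
  then show "set_integrable lborel {0..} (student_density p)" "student_tail p 0 = 1 / 2"
    unfolding set_integrable_def student_tail_def set_lebesgue_integral_def
    by (auto simp: has_bochner_integral_iff)
qed

text \<open>Up to the factor \<open>1 / sqrt (2 * pi)\<close>, the density at 0 is the Gamma ratio
  at half the degrees of freedom. In the normal case this ratio is replaced by 1.\<close>

lemma student_density_0_strict_mono:
  assumes "0 < p" "p < q"
  shows "student_density p 0 < student_density q 0"
proof -
  have eq: "student_density (ereal r) 0 = Gamma (r / 2 + 1 / 2) / (sqrt (r / 2) * Gamma (r / 2)) / sqrt (2 * pi)"
    if "r > 0" for r
    using that by (simp add: student_density_ereal add_divide_distrib real_sqrt_mult real_sqrt_divide)
  obtain r where r: "p = ereal r" "0 < r"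
    using assms by (cases p) auto
  have "0 < q"
    using assms by simp
  then show ?thesis
  proof (cases rule: pos_ereal_cases)
    case (1 s)
    then have "Gamma (r / 2 + 1 / 2) / (sqrt (r / 2) * Gamma (r / 2)) < Gamma (s / 2 + 1 / 2) / (sqrt (s / 2) * Gamma (s / 2))"
      using assms r by (intro Gamma_half_ratio_strict_mono) auto
    then show ?thesis
      unfolding r 1 eq[OF r(2)] eq[OF 1(2)] by (rule divide_strict_right_mono) simp
  next
    case 2
    have "Gamma (r / 2 + 1 / 2) / (sqrt (r / 2) * Gamma (r / 2)) < 1"
      using r by (intro Gamma_half_ratio_less_1) auto
    then have "student_density p 0 < 1 / sqrt (2 * pi)"
      unfolding r eq[OF r(2)] by (rule divide_strict_right_mono) simp
    then show ?thesis
      using 2 by (simp add: student_density_PInfty std_normal_density_def)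
  qed
qed

text \<open>The difference of the two scores is a positive multiple of \<open>x^2 - 1\<close>, so
  they cross at 1 whatever \<open>p\<close> and \<open>q\<close> are.\<close>

lemma student_score_less_iff:
  assumes "0 < p" "p < q" "0 < x"
  shows "student_score p x < student_score q x \<longleftrightarrow> 1 < x"
proof -
  have sq: "1 < x\<^sup>2 \<longleftrightarrow> 1 < x"
    using assms power_less_imp_less_base[of 1 2 x] one_less_power[of x 2] by auto
  obtain r where r: "p = ereal r" "0 < r"
    using assms by (cases p) auto
  have r': "r + x\<^sup>2 > 0"
    using r by (simp add: add_pos_nonneg)
  have "0 < q"
    using assms by simp
  then show ?thesis
  proof (cases rule: pos_ereal_cases)
    case (1 s)
    have s': "s + x\<^sup>2 > 0"
      using 1 by (simp add: add_pos_nonneg)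
    have "student_score q x - student_score p x = x * (s - r) / ((r + x\<^sup>2) * (s + x\<^sup>2)) * (x\<^sup>2 - 1)"
      using r 1 r' s' by (simp add: student_score_def divide_simps) (simp add: algebra_simps)
    moreover have "x * (s - r) / ((r + x\<^sup>2) * (s + x\<^sup>2)) > 0"
      using r 1 r' s' assms by simp
    ultimately have "0 < student_score q x - student_score p x \<longleftrightarrow> 0 < x\<^sup>2 - 1"
      by (metis zero_less_mult_pos mult_pos_pos)
    then show ?thesis
      by (simp add: sq)
  next
    case 2
    have "student_score q x - student_score p x = x / (r + x\<^sup>2) * (x\<^sup>2 - 1)"
      using r 2 r' by (simp add: student_score_def field_simps)
    moreover have "x / (r + x\<^sup>2) > 0"
      using r' assms by simp
    ultimately have "0 < student_score q x - student_score p x \<longleftrightarrow> 0 < x\<^sup>2 - 1"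
      by (metis zero_less_mult_pos mult_pos_pos)
    then show ?thesis
      by (simp add: sq)
  qed
qed

section \<open>Monotone tail ratio and stochastic majorization\<close>

theorem theorem1p1:
  fixes p q :: ereal
  assumes "0 < p" and "p < q" and "q \<le> \<infinity>"
  shows "strict_antimono_on {0::real..} (\<lambda>x. student_tail q x / student_tail p x)
    \<and> (\<forall>x::real. x > 0 \<longrightarrow> student_tail q x < student_tail p x)"
proof
  have q: "0 < q"
    using assms by simp
  have tail: "(student_tail r has_real_derivative - student_density r x) (at x)"
      "(student_tail r \<longlongrightarrow> 0) at_top" if "0 < r" for r x
    unfolding student_tail_def[abs_def]
    using has_real_derivative_tail_integral[OF continuous_on_student_density student_density_half_mass(1)]
      tail_integral_tendsto_0[OF student_density_half_mass(1)] that by blast+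
  show anti: "strict_antimono_on {0..} (\<lambda>x. student_tail q x / student_tail p x)"
  proof (rule tail_ratio_strict_antimono_on)
    show "student_score q x \<le> student_score p x" if "0 \<le> x" "x \<le> 1" for x
      using student_score_less_iff[OF assms(1,2), of x] that
      \<comment> \<open>At 0, which the comparison of scores excludes, both scores vanish.\<close>
      by (cases "x = 0") (auto simp: student_score_def)
    show "student_score p x < student_score q x" if "1 < x" for x
      using student_score_less_iff[OF assms(1,2), of x] that by simp
    show "student_tail p 0 = student_tail q 0"
      using assms(1) q by (simp only: student_density_half_mass(2))
  qed (use assms q tail has_real_derivative_student_density student_density_pos
      student_density_0_strict_mono in auto)
  show "\<forall>x>0. student_tail q x < student_tail p x"
  proof (intro allI impI)
    fix x :: real
    assume "x > 0"
    \<comment> \<open>The ratio equals 1 at 0, where both tails are \<open>1 / 2\<close>, and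
      strictly decreases from there.\<close>
    then have "student_tail q x / student_tail p x < 1"
      using monotone_onD[OF anti, of 0 x] student_density_half_mass(2)[OF assms(1)]
        student_density_half_mass(2)[OF q] by simp
    moreover have "0 < student_tail p x"
      by (rule DERIV_neg_imp_decreasing_at_top[OF _ tail(2)[OF assms(1)]])
        (use tail(1)[OF assms(1)] student_density_pos[OF assms(1)] in fastforce)
    ultimately show "student_tail q x < student_tail p x"
      by simp
  qed
qed

end
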